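(* Let $\alpha\in\mathbb Z\setminus\{0,1\}$ and let $(h_n)$ be the sequence with $h_0=0$, $h_1=1$, $h_2=-\alpha^2(\alpha-1)$, $h_3=-\alpha^6(\alpha-1)^3$, $h_4=\alpha^{11}(\alpha-1)^6$, and for $m\ge2$: $h_{2m+1}=h_{m+2}h_m^3-h_{m-1}h_{m+1}^3$, for $m\ge 3$: $h_{2m}=h_m\big(h_{m+2}h_{m-1}^2-h_{m-2}h_{m+1}^2\big)/h_2$. (i) If $n\equiv 6,8\pmod{14}$, then $h_n$ is not a square. (ii) If $n\equiv 2,5,16,19\pmod{21}$, then $h_n$ is not a cube.
   Context: The sequence defined is the elliptic divisibility sequence attached to the point $(0,0)$ of order $7$ on the Tate normal form curve with $b=\alpha^3-\alpha^2$, $c=\alpha^2-\alpha$. Convention: an integer $m$ is called a square if $m=\pm\beta^2$ for some nonzero integer $\beta$, and a cube if $m=\beta^3$ for some nonzero integer $\beta$. *)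

theory Defs
  imports Complex_Main "HOL-Number_Theory.Cong"
begin

text \<open>
  Non-standard convention: a square may carry either sign, and zero counts neither as a
  square nor as a cube.
\<close>

definition signed_square :: "int \<Rightarrow> bool" where
  "signed_square m \<longleftrightarrow> (\<exists>\<beta>::int. \<beta> \<noteq> 0 \<and> (m = \<beta>\<^sup>2 \<or> m = - (\<beta>\<^sup>2)))"

definition nonzero_cube :: "int \<Rightarrow> bool" where
  "nonzero_cube m \<longleftrightarrow> (\<exists>\<beta>::int. \<beta> \<noteq> 0 \<and> m = \<beta> ^ 3)"

text \<open>
  The sequence obtained from the point \<open>(0,0)\<close> of order 7 on the Tate normal form curve with
  \<open>b = \<alpha>\<^sup>3 - \<alpha>\<^sup>2\<close>, \<open>c = \<alpha>\<^sup>2 - \<alpha>\<close>, given by its initial values and duplication formulas.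
  It is rational-valued so that the division by \<open>h 2\<close> is the true one;
  integrality of its terms is a consequence, not part of the definition.
  The conditions determine \<open>h\<close> uniquely for each \<open>\<alpha>\<close>.
\<close>

definition tate7_eds :: "int \<Rightarrow> (nat \<Rightarrow> rat) \<Rightarrow> bool" where
  "tate7_eds \<alpha> h \<longleftrightarrow>
     h 0 = 0 \<and> h 1 = 1 \<and>
     h 2 = of_int (- (\<alpha>\<^sup>2 * (\<alpha> - 1))) \<and>
     h 3 = of_int (- (\<alpha> ^ 6 * (\<alpha> - 1) ^ 3)) \<and>
     h 4 = of_int (\<alpha> ^ 11 * (\<alpha> - 1) ^ 6) \<and>
     (\<forall>m\<ge>2. h (2 * m + 1) = h (m + 2) * h m ^ 3 - h (m - 1) * h (m + 1) ^ 3) \<and>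
     (\<forall>m\<ge>3. h (2 * m) = h m * (h (m + 2) * (h (m - 1))\<^sup>2 - h (m - 2) * (h (m + 1))\<^sup>2) / h 2)"

end

theory Submission
  imports Defs "HOL-Computational_Algebra.Nth_Powers"
begin

text \<open>
  Since \<open>(0,0)\<close> has order 7, the sequence is quasi-periodic: with \<open>u = \<alpha>\<^sup>5 (\<alpha> - 1)\<^sup>3\<close> one has
  \<open>h (n + 7) = u ^ (2 n + 7) h n\<close>, because both duplication formulas are homogeneous under
  this shift. Hence \<open>h (7 k + r) = u ^ (7 k\<^sup>2 + 2 k r) h r\<close>. In the residue classes of (i) this is
  \<open>\<alpha> (\<alpha> - 1)\<close> times a signed square, and \<open>\<alpha> (\<alpha> - 1)\<close> lies strictly between consecutive squares.
  In the classes of (ii) it is \<open>\<alpha>\<^sup>2 (\<alpha> - 1)\<close> times a cube, which by coprimality would force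
  \<open>\<alpha>\<close> and \<open>\<alpha> - 1\<close> both to be cubes.
\<close>

section \<open>Monomial form of the sequence and its shift by 7\<close>

text \<open>Here \<open>b\<close> stands for \<alpha> - 1. Keeping it a separate variable makes
  every value zero or a signed monomial in \<open>a\<close> and \<open>b\<close>, so identities
  reduce to comparing exponents. Quasi-periodicity is built into the recursion; the elliptic
  recurrences are what must be proved.\<close>

fun tate7_form :: "int \<Rightarrow> int \<Rightarrow> nat \<Rightarrow> int" where
  "tate7_form a b n =
     (if n = 0 then 0 else if n = 1 then 1 else if n = 2 then - (a\<^sup>2 * b)
      else if n = 3 then - (a ^ 6 * b ^ 3) else if n = 4 then a ^ 11 * b ^ 6
      else if n = 5 then a ^ 17 * b ^ 10 else if n = 6 then - (a ^ 25 * b ^ 15)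
      else (a ^ 5 * b ^ 3) ^ (2 * (n - 7) + 7) * tate7_form a b (n - 7))"

declare tate7_form.simps [simp del]

lemma tate7_form_small:
  "tate7_form a b 0 = 0" "tate7_form a b 1 = 1" "tate7_form a b 2 = - (a\<^sup>2 * b)"
  "tate7_form a b 3 = - (a ^ 6 * b ^ 3)" "tate7_form a b 4 = a ^ 11 * b ^ 6"
  "tate7_form a b 5 = a ^ 17 * b ^ 10" "tate7_form a b 6 = - (a ^ 25 * b ^ 15)"
  by (simp_all add: tate7_form.simps)

lemma tate7_form_add_7:
  "tate7_form a b (n + 7) = (a ^ 5 * b ^ 3) ^ (2 * n + 7) * tate7_form a b n"
  by (subst tate7_form.simps) simp

text \<open>Replacing m by m + 7 moves the indices 2m and 2m + 1 by 14. Two shifts by 7 contribute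
  (2n + 7) + (2(n + 7) + 7) to the exponent.\<close>

lemma tate7_form_add_14:
  "tate7_form a b (n + 14) = (a ^ 5 * b ^ 3) ^ (4 * n + 28) * tate7_form a b n"
  using tate7_form_add_7[of a b "n + 7"] tate7_form_add_7[of a b n]
  by (simp add: add.assoc flip: power_add)

text \<open>The exponent is the sum of 2(7i + r) + 7 over i < k.\<close>

lemma tate7_form_closed:
  "tate7_form a b (7 * k + r) = (a ^ 5 * b ^ 3) ^ (7 * k\<^sup>2 + 2 * k * r) * tate7_form a b r"
proof (induction k)
  case (Suc k)
  have "tate7_form a b (7 * Suc k + r) = tate7_form a b ((7 * k + r) + 7)"
    by (simp add: algebra_simps)
  also have "\<dots> = (a ^ 5 * b ^ 3) ^ ((2 * (7 * k + r) + 7) + (7 * k\<^sup>2 + 2 * k * r)) * tate7_form a b r"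
    unfolding tate7_form_add_7 Suc by (simp add: power_add)
  also have "(2 * (7 * k + r) + 7) + (7 * k\<^sup>2 + 2 * k * r) = 7 * (Suc k)\<^sup>2 + 2 * Suc k * r"
    by (simp add: power2_eq_square algebra_simps)
  finally show ?case .
qed simp

text \<open>Index 18 is the largest one occurring in the base cases below: 2m + 1 with m \<le> 8 and
  2m with m \<le> 9.\<close>

lemma tate7_form_values:
  "tate7_form a b 7 = 0" "tate7_form a b 8 = a ^ 45 * b ^ 27"
  "tate7_form a b 9 = - (a ^ 57 * b ^ 34)" "tate7_form a b 10 = - (a ^ 71 * b ^ 42)"
  "tate7_form a b 11 = a ^ 86 * b ^ 51" "tate7_form a b 12 = a ^ 102 * b ^ 61"
  "tate7_form a b 13 = - (a ^ 120 * b ^ 72)" "tate7_form a b 14 = 0"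
  "tate7_form a b 15 = a ^ 160 * b ^ 96" "tate7_form a b 16 = - (a ^ 182 * b ^ 109)"
  "tate7_form a b 17 = - (a ^ 206 * b ^ 123)" "tate7_form a b 18 = a ^ 231 * b ^ 138"
  by (simp_all add: tate7_form.simps power_mult_distrib mult.assoc mult.left_commute
        power_mult_numeral flip: power_add power_Suc power_Suc2)

section \<open>The duplication formulas for the monomial form\<close>

lemma nat_induct_step_7:
  fixes P :: "nat \<Rightarrow> bool"
  assumes "s \<le> m"
    and base: "\<And>m. s \<le> m \<Longrightarrow> m < s + 7 \<Longrightarrow> P m"
    and step: "\<And>m. s \<le> m \<Longrightarrow> P m \<Longrightarrow> P (m + 7)"
  shows "P m"
  using assms(1)
proof (induction m rule: less_induct)
  case (less m)
  show ?case
  proof (cases "m < s + 7")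
    case False
    then have "P (m - 7 + 7)"
      using less by (intro step) auto
    then show ?thesis using False by simp
  qed (use base less in blast)
qed

text \<open>Both sides scale by the same power of \<open>u\<close> under m -> m + 7, so seven
  consecutive values of m suffice.\<close>

lemma tate7_form_odd:
  assumes "a = b + 1" and "m \<ge> 2"
  shows "tate7_form a b (2 * m + 1) =
    tate7_form a b (m + 2) * tate7_form a b m ^ 3 - tate7_form a b (m - 1) * tate7_form a b (m + 1) ^ 3"
  using \<open>m \<ge> 2\<close>
proof (induction m rule: nat_induct_step_7[consumes 1, case_names base step])
  case (base m)
  have pred: "a - 1 = b"
    using \<open>a = b + 1\<close> by simp
  note vals = tate7_form_small[simplified] tate7_form_values
  from base consider "m = 2" | "m = 3" | "m = 4" | "m = 5" | "m = 6" | "m = 7" | "m = 8"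
    by linarith
  \<comment> \<open>For m = 2 and m = 4 no index is a multiple of 7; the two products differ by one
    factor \<open>a\<close>, and their difference yields \<open>a - 1 = b\<close>. For the other m a
    multiple of 7 kills a term, leaving an identity of monomials.\<close>
  then show ?case
  proof cases
    case 1
    have "tate7_form a b 4 * tate7_form a b 2 ^ 3 - tate7_form a b 1 * tate7_form a b 3 ^ 3
        = a ^ 17 * b ^ 9 * (a - 1)"
      unfolding tate7_form_small tate7_form_values by algebra
    also have "\<dots> = tate7_form a b 5"
      unfolding pred tate7_form_small tate7_form_values by algebra
    finally show ?thesis
      using 1 by simp
  next
    case 2
    show ?thesis
      by (simp add: 2 vals; algebra)
  next
    case 3
    have "tate7_form a b 6 * tate7_form a b 4 ^ 3 - tate7_form a b 3 * tate7_form a b 5 ^ 3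
        = - (a ^ 57 * b ^ 33 * (a - 1))"
      unfolding tate7_form_small tate7_form_values by algebra
    also have "\<dots> = tate7_form a b 9"
      unfolding pred tate7_form_small tate7_form_values by algebra
    finally show ?thesis
      using 3 by simp
  next
    case 4
    show ?thesis
      by (simp add: 4 vals; algebra)
  next
    case 5
    show ?thesis
      by (simp add: 5 vals; algebra)
  next
    case 6
    show ?thesis
      by (simp add: 6 vals; algebra)
  next
    case 7
    show ?thesis
      by (simp add: 7 vals; algebra)
  qed
next
  case (step m)
  define u where "u = a ^ 5 * b ^ 3"
  define f where "f = tate7_form a b"
  have shift: "f n' = u ^ e * f n" if "n' = n + 7" "e = 2 * n + 7" for n n' e
    unfolding u_def f_def that by (rule tate7_form_add_7)
  have shift2: "f n' = u ^ e * f n" if "n' = n + 14" "e = 4 * n + 28" for n n' e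
    unfolding u_def f_def that by (rule tate7_form_add_14)
  \<comment> \<open>Homogeneity: 4(2m + 1) + 28 = (2m + 11) + 3(2m + 7) = (2m + 5) + 3(2m + 9) = 8m
    + 32.\<close>
  have "f (2 * (m + 7) + 1) = u ^ (8 * m + 32) * f (2 * m + 1)"
    by (rule shift2) simp_all
  moreover have "f (m + 7 + 2) * f (m + 7) ^ 3 = u ^ (8 * m + 32) * (f (m + 2) * f m ^ 3)"
  proof -
    have "f (m + 7 + 2) = u ^ (2 * m + 11) * f (m + 2)" "f (m + 7) = u ^ (2 * m + 7) * f m"
      by (rule shift; simp)+
    moreover have "u ^ (8 * m + 32) = u ^ (2 * m + 11) * (u ^ (2 * m + 7)) ^ 3"
      by (simp flip: power_add power_mult)
    ultimately show ?thesis
      by (simp only: power_mult_distrib mult_ac)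
  qed
  moreover have "f (m + 7 - 1) * f (m + 7 + 1) ^ 3 = u ^ (8 * m + 32) * (f (m - 1) * f (m + 1) ^ 3)"
  proof -
    \<comment> \<open>Subtraction is truncated: \<open>m + 7 - 1 = (m - 1) + 7\<close> requires m
      \<ge> 1.\<close>
    have "f (m + 7 - 1) = u ^ (2 * m + 5) * f (m - 1)" "f (m + 7 + 1) = u ^ (2 * m + 9) * f (m + 1)"
      by (rule shift; use \<open>2 \<le> m\<close> in simp)+
    moreover have "u ^ (8 * m + 32) = u ^ (2 * m + 5) * (u ^ (2 * m + 9)) ^ 3"
      by (simp flip: power_add power_mult)
    ultimately show ?thesis
      by (simp only: power_mult_distrib mult_ac)
  qed
  ultimately show ?case
    using step.IH by (simp only: right_diff_distrib flip: f_def)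
qed

text \<open>Multiplying through by the value at 2 keeps the formula in the integers. That factor is
  not shifted, and all remaining terms scale by \<open>u ^ (8 * m + 28)\<close>.\<close>

lemma tate7_form_even:
  assumes "a = b + 1" and "m \<ge> 3"
  shows "tate7_form a b 2 * tate7_form a b (2 * m) =
    tate7_form a b m * (tate7_form a b (m + 2) * (tate7_form a b (m - 1))\<^sup>2
      - tate7_form a b (m - 2) * (tate7_form a b (m + 1))\<^sup>2)"
  using \<open>m \<ge> 3\<close>
proof (induction m rule: nat_induct_step_7[consumes 1, case_names base step])
  case (base m)
  have pred: "a - 1 = b"
    using \<open>a = b + 1\<close> by simp
  note vals = tate7_form_small[simplified] tate7_form_values
  from base consider "m = 3" | "m = 4" | "m = 5" | "m = 6" | "m = 7" | "m = 8" | "m = 9"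
    by linarith
  \<comment> \<open>Here m = 3 and m = 4 are the cases without a multiple of 7 among the indices,
    where \<open>a - 1 = b\<close> is needed.\<close>
  then show ?case
  proof cases
    case 1
    have "tate7_form a b 3 * (tate7_form a b 5 * (tate7_form a b 2)\<^sup>2 - tate7_form a b 1 * (tate7_form a b 4)\<^sup>2)
        = a ^ 27 * b ^ 15 * (a - 1)"
      unfolding tate7_form_small tate7_form_values by algebra
    also have "\<dots> = tate7_form a b 2 * tate7_form a b 6"
      unfolding pred tate7_form_small tate7_form_values by algebra
    finally show ?thesis
      using 1 by simp
  next
    case 2
    have "tate7_form a b 4 * (tate7_form a b 6 * (tate7_form a b 3)\<^sup>2 - tate7_form a b 2 * (tate7_form a b 5)\<^sup>2)
        = - (a ^ 47 * b ^ 27 * (a - 1))"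
      unfolding tate7_form_small tate7_form_values by algebra
    also have "\<dots> = tate7_form a b 2 * tate7_form a b 8"
      unfolding pred tate7_form_small tate7_form_values by algebra
    finally show ?thesis
      using 2 by simp
  next
    case 3
    show ?thesis
      by (simp add: 3 vals; algebra)
  next
    case 4
    show ?thesis
      by (simp add: 4 vals; algebra)
  next
    case 5
    show ?thesis
      by (simp add: 5 vals; algebra)
  next
    case 6
    show ?thesis
      by (simp add: 6 vals; algebra)
  next
    case 7
    show ?thesis
      by (simp add: 7 vals; algebra)
  qed
next
  case (step m)
  define u where "u = a ^ 5 * b ^ 3"
  define f where "f = tate7_form a b"
  have shift: "f n' = u ^ e * f n" if "n' = n + 7" "e = 2 * n + 7" for n n' e
    unfolding u_def f_def that by (rule tate7_form_add_7)
  have shift2: "f n' = u ^ e * f n" if "n' = n + 14" "e = 4 * n + 28" for n n' e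
    unfolding u_def f_def that by (rule tate7_form_add_14)
  have m: "f (m + 7) = u ^ (2 * m + 7) * f m"
    by (rule shift) simp_all
  have "f (2 * (m + 7)) = u ^ (8 * m + 28) * f (2 * m)"
    by (rule shift2) simp_all
  moreover have "f (m + 7) * (f (m + 7 + 2) * (f (m + 7 - 1))\<^sup>2)
      = u ^ (8 * m + 28) * (f m * (f (m + 2) * (f (m - 1))\<^sup>2))"
  proof -
    have "f (m + 7 + 2) = u ^ (2 * m + 11) * f (m + 2)" "f (m + 7 - 1) = u ^ (2 * m + 5) * f (m - 1)"
      by (rule shift; use \<open>3 \<le> m\<close> in simp)+
    moreover have "u ^ (8 * m + 28) = u ^ (2 * m + 7) * (u ^ (2 * m + 11) * (u ^ (2 * m + 5)) ^ 2)"
      by (simp flip: power_add power_mult)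
    ultimately show ?thesis
      by (simp only: m power_mult_distrib mult_ac)
  qed
  moreover have "f (m + 7) * (f (m + 7 - 2) * (f (m + 7 + 1))\<^sup>2)
      = u ^ (8 * m + 28) * (f m * (f (m - 2) * (f (m + 1))\<^sup>2))"
  proof -
    have "f (m + 7 - 2) = u ^ (2 * m + 3) * f (m - 2)" "f (m + 7 + 1) = u ^ (2 * m + 9) * f (m + 1)"
      by (rule shift; use \<open>3 \<le> m\<close> in simp)+
    moreover have "u ^ (8 * m + 28) = u ^ (2 * m + 7) * (u ^ (2 * m + 3) * (u ^ (2 * m + 9)) ^ 2)"
      by (simp flip: power_add power_mult)
    ultimately show ?thesis
      by (simp only: m power_mult_distrib mult_ac)
  qed
  ultimately show ?case
    using step.IH by (simp only: right_diff_distrib mult.left_commute[of "f 2"] flip: f_def)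
qed

section \<open>Identification of the sequence with the monomial form\<close>

lemma tate7_eds_eq_form:
  assumes "\<alpha> \<notin> {0, 1}" and "tate7_eds \<alpha> h"
  shows "h n = of_int (tate7_form \<alpha> (\<alpha> - 1) n)"
proof (induction n rule: less_induct)
  case (less n)
  let ?H = "tate7_form \<alpha> (\<alpha> - 1)"
  have init: "h 0 = 0" "h 1 = 1" "h 2 = of_int (- (\<alpha>\<^sup>2 * (\<alpha> - 1)))"
      "h 3 = of_int (- (\<alpha> ^ 6 * (\<alpha> - 1) ^ 3))" "h 4 = of_int (\<alpha> ^ 11 * (\<alpha> - 1) ^ 6)"
    and odd: "\<And>m. m \<ge> 2 \<Longrightarrow> h (2 * m + 1) = h (m + 2) * h m ^ 3 - h (m - 1) * h (m + 1) ^ 3"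
    and even: "\<And>m. m \<ge> 3 \<Longrightarrow>
      h (2 * m) = h m * (h (m + 2) * (h (m - 1))\<^sup>2 - h (m - 2) * (h (m + 1))\<^sup>2) / h 2"
    using assms(2) unfolding tate7_eds_def by auto
  \<comment> \<open>These bounds put the largest index m + 2 on the right-hand sides below n, so the
    induction hypothesis covers every term.\<close>
  consider "n < 5" | m where "n = 2 * m + 1" "m \<ge> 2" | m where "n = 2 * m" "m \<ge> 3"
  proof (cases "n < 5")
    case False
    then show ?thesis
      using that(2)[of "n div 2"] that(3)[of "n div 2"] by (cases "even n") auto
  qed
  then show ?case
  proof cases
    case 1
    then consider "n = 0" | "n = 1" | "n = 2" | "n = 3" | "n = 4" by linarith
    then show ?thesis
      by cases (simp_all only: init tate7_form_small of_int_0 of_int_1)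
  next
    case (2 m)
    have "h n = h (m + 2) * h m ^ 3 - h (m - 1) * h (m + 1) ^ 3"
      using 2 odd by simp
    also have "\<dots> = of_int (?H (m + 2) * ?H m ^ 3 - ?H (m - 1) * ?H (m + 1) ^ 3)"
      using 2 less[of "m + 2"] less[of m] less[of "m - 1"] less[of "m + 1"] by simp
    also have "\<dots> = of_int (?H n)"
      using 2 by (simp only: tate7_form_odd)
    finally show ?thesis .
  next
    case (3 m)
    have h2: "h 2 = of_int (?H 2)"
      by (simp only: init tate7_form_small)
    have "?H 2 \<noteq> 0"
      using assms(1) by (simp add: tate7_form_small)
    have "h n = h m * (h (m + 2) * (h (m - 1))\<^sup>2 - h (m - 2) * (h (m + 1))\<^sup>2) / h 2"
      using 3 even by simp
    also have "\<dots> = of_int (?H m * (?H (m + 2) * (?H (m - 1))\<^sup>2 - ?H (m - 2) * (?H (m + 1))\<^sup>2)) / of_int (?H 2)"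
      using 3 less[of "m + 2"] less[of m] less[of "m - 1"] less[of "m - 2"] less[of "m + 1"] h2
      by simp
    also have "?H m * (?H (m + 2) * (?H (m - 1))\<^sup>2 - ?H (m - 2) * (?H (m + 1))\<^sup>2) = ?H 2 * ?H n"
      using 3 tate7_form_even[of \<alpha> "\<alpha> - 1" m] by simp
    also have "of_int (?H 2 * ?H n) / of_int (?H 2) = (of_int (?H n) :: rat)"
      using \<open>?H 2 \<noteq> 0\<close> by simp
    finally show ?thesis .
  qed
qed

section \<open>Consecutive integers, squares and cubes\<close>

text \<open>Completing the square turns equality into (2a - 1)^2 - (2q)^2 = 1. The two factors of
  this difference are integers with product 1, hence equal, which forces q = 0.\<close>

lemma consecutive_product_not_square:
  fixes a q :: int
  assumes "a \<notin> {0, 1}"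
  shows "a * (a - 1) \<noteq> q\<^sup>2"
proof
  assume "a * (a - 1) = q\<^sup>2"
  then have "(2 * a - 1 - 2 * q) * (2 * a - 1 + 2 * q) = 1"
    by (simp add: power2_eq_square algebra_simps)
  then have "2 * a - 1 - 2 * q = 2 * a - 1 + 2 * q"
    by (auto simp: zmult_eq_1_iff)
  then have "q = 0" by simp
  then show False
    using \<open>a * (a - 1) = q\<^sup>2\<close> assms by simp
qed

text \<open>The absolute value absorbs both signs allowed by \<open>signed_square\<close>; then t^2
  can be cancelled because t^2 dividing s^2 gives t dividing s.\<close>

lemma consecutive_product_times_square_not_signed_square:
  fixes a t :: int
  assumes "a \<notin> {0, 1}" and "\<bar>k\<bar> = a * (a - 1) * t\<^sup>2"
  shows "\<not> signed_square k"
proof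
  assume "signed_square k"
  then obtain s where s: "s \<noteq> 0" "\<bar>k\<bar> = s\<^sup>2"
    unfolding signed_square_def by auto
  then have eq: "s\<^sup>2 = a * (a - 1) * t\<^sup>2" and "t \<noteq> 0"
    using assms(2) by auto
  then have "t\<^sup>2 dvd s\<^sup>2" by simp
  then obtain q where "s = t * q" by auto
  then have "a * (a - 1) = q\<^sup>2"
    using eq \<open>t \<noteq> 0\<close> by (simp add: power_mult_distrib)
  then show False
    using consecutive_product_not_square assms(1) by blast
qed

text \<open>The gap (q + 1)^3 - q^3 = 3q^2 + 3q + 1 exceeds 1 for q > 0.\<close>

lemma nat_cubes_not_consecutive:
  fixes p q :: nat
  assumes "p ^ 3 = q ^ 3 + 1"
  shows "q = 0"
proof (rule ccontr)
  assume "q \<noteq> 0"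
  have "q < p"
    using assms power_less_imp_less_base[of q 3 p] by simp
  then have "(q + 1) ^ 3 \<le> p ^ 3"
    by (intro power_mono) auto
  with assms \<open>q \<noteq> 0\<close> show False
    by (simp add: power3_eq_cube algebra_simps)
qed

text \<open>If x^2 is a cube, so is x^4 = x^3 * x, and the cube x^3 cancels.\<close>

lemma is_cube_of_is_cube_square:
  fixes x :: nat
  assumes "is_nth_power 3 (x\<^sup>2)"
  shows "is_nth_power 3 x"
proof (cases "x = 0")
  case False
  have "is_nth_power 3 (x\<^sup>2 * x\<^sup>2)"
    using assms is_nth_power_mult by blast
  moreover have "x\<^sup>2 * x\<^sup>2 = x ^ 3 * x"
    by (simp add: power2_eq_square power3_eq_cube)
  ultimately show ?thesis
    using is_nth_power_mult_cancel_left[of 3 "x ^ 3" x] False by simp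
qed simp

text \<open>The coprime factors |a|^2 and |a - 1| of a cube are cubes, hence so is |a|. Then |a| and
  |a - 1| are consecutive naturals that are both cubes, so the smaller is 0.\<close>

lemma square_times_pred_not_cube:
  fixes a q :: int
  assumes "a \<notin> {0, 1}"
  shows "a\<^sup>2 * (a - 1) \<noteq> q ^ 3"
proof
  assume eq: "a\<^sup>2 * (a - 1) = q ^ 3"
  let ?x = "nat \<bar>a\<bar>" and ?y = "nat \<bar>a - 1\<bar>"
  have "?x\<^sup>2 * ?y = nat \<bar>q\<bar> ^ 3"
    using arg_cong[OF eq, of "\<lambda>z. nat \<bar>z\<bar>"]
    by (simp only: abs_mult power_abs nat_mult_distrib nat_power_eq abs_ge_zero zero_le_power)

  then have "is_nth_power 3 (?x\<^sup>2 * ?y)"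
    by (rule is_nth_powerI)
  moreover have "coprime ?x ?y"
    by (simp add: coprime_doff_one_right)
  ultimately have "is_nth_power 3 (?x\<^sup>2)" "is_nth_power 3 ?y"
    using is_nth_power_mult_coprime_natD[of "?x\<^sup>2" ?y 3] assms by auto
  then obtain v w where vw: "?x = v ^ 3" "?y = w ^ 3"
    using is_cube_of_is_cube_square by (meson is_nth_powerE)
  have "?x = ?y + 1 \<or> ?y = ?x + 1"
    using assms by (cases "a \<ge> 1") auto
  then show False
    using nat_cubes_not_consecutive[of v w] nat_cubes_not_consecutive[of w v] vw assms by auto
qed

lemma square_times_pred_times_cube_not_nonzero_cube:
  fixes a t :: int
  assumes "a \<notin> {0, 1}" and "k = a\<^sup>2 * (a - 1) * t ^ 3"
  shows "\<not> nonzero_cube k"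
proof
  assume "nonzero_cube k"
  then obtain s where s: "s \<noteq> 0" "s ^ 3 = a\<^sup>2 * (a - 1) * t ^ 3"
    using assms(2) unfolding nonzero_cube_def by auto
  then have "t \<noteq> 0" by auto
  have "t ^ 3 dvd s ^ 3" using s by simp
  then obtain q where "s = t * q" by auto
  then have "a\<^sup>2 * (a - 1) = q ^ 3"
    using s \<open>t \<noteq> 0\<close> by (simp add: power_mult_distrib)
  then show False
    using square_times_pred_not_cube assms(1) by blast
qed

section \<open>The residue classes modulo 14 and 21\<close>

text \<open>Up to sign these values are odd powers of u = a^5 b^3 = ab (a^2 b)^2. The sign condition
  makes |ab| = ab.\<close>

lemma abs_tate7_form_mod_14:
  assumes "n mod 14 = 6 \<or> n mod 14 = 8" and "0 \<le> a * b"
  shows "\<exists>t. \<bar>tate7_form a b n\<bar> = a * b * t\<^sup>2"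
proof -
  define u where "u = a ^ 5 * b ^ 3"
  have "\<exists>e. \<bar>tate7_form a b n\<bar> = \<bar>u\<bar> ^ (2 * e + 1)"
  proof (cases "n mod 14 = 6")
    case True
    then have n: "n = 7 * (2 * (n div 14)) + 6"
      by presburger
    define j where "j = n div 14"
    have "tate7_form a b 6 = - (u ^ 5)"
      by (simp add: tate7_form_small u_def power_mult_distrib flip: power_mult)
    then have "\<bar>tate7_form a b n\<bar> = \<bar>u\<bar> ^ (28 * j\<^sup>2 + 24 * j) * \<bar>u ^ 5\<bar>"
      by (subst n, subst tate7_form_closed)
        (simp add: j_def abs_mult power_abs power_mult_distrib[of 2] flip: u_def)
    also have "\<dots> = \<bar>u\<bar> ^ ((28 * j\<^sup>2 + 24 * j) + 5)"
      by (simp only: power_abs power_add)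
    also have "(28 * j\<^sup>2 + 24 * j) + 5 = 2 * (14 * j\<^sup>2 + 12 * j + 2) + 1"
      by simp
    finally show ?thesis by blast
  next
    \<comment> \<open>Residue 8 is written as 7k + 1 with k odd: the value at 1 is 1, and 7k^2 + 2k
      is then odd.\<close>
    case False
    then have n: "n = 7 * (2 * (n div 14) + 1) + 1"
      using assms(1) by presburger
    define j where "j = n div 14"
    have "\<bar>tate7_form a b n\<bar> = \<bar>u\<bar> ^ (7 * (2 * j + 1)\<^sup>2 + 2 * (2 * j + 1) * 1)"
      by (subst n, subst tate7_form_closed)
        (simp only: tate7_form_small u_def j_def power_abs abs_mult abs_one mult_1_right)
    also have "7 * (2 * j + 1)\<^sup>2 + 2 * (2 * j + 1) * 1 = 2 * (14 * j\<^sup>2 + 16 * j + 4) + 1"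
      by (simp add: power2_eq_square algebra_simps)
    finally show ?thesis by blast
  qed
  then obtain e where "\<bar>tate7_form a b n\<bar> = \<bar>u\<bar> ^ (2 * e + 1)" by blast
  also have "\<dots> = \<bar>u\<bar> * (u ^ e)\<^sup>2"
    by (simp only: power_add power_one_right power_mult power2_abs)
      (simp add: mult.commute flip: power_mult)
  also have "u = a * b * (a\<^sup>2 * b)\<^sup>2"
    unfolding u_def by algebra
  also have "\<bar>a * b * (a\<^sup>2 * b)\<^sup>2\<bar> = a * b * (a\<^sup>2 * b)\<^sup>2"
    using assms(2) by (rule abs_of_nonneg[OF mult_nonneg_nonneg]) auto
  finally show ?thesis
    by (metis mult.assoc power_mult_distrib)
qed

text \<open>For r = 2 and r = 5 the exponent 7k^2 + 2kr is congruent to k(k + 1) modulo 3, so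
  \<open>u\<close> occurs to a power divisible by 3 exactly for k = 0 or 2 modulo 3. Then 7k + r
  runs through the four listed classes.\<close>

lemma tate7_form_mod_21:
  assumes "n mod 21 \<in> {2, 5, 16, 19}"
  shows "\<exists>t. tate7_form a b n = a\<^sup>2 * b * t ^ 3"
proof -
  define u where "u = a ^ 5 * b ^ 3"
  define j where "j = n div 21"
  have closed: "tate7_form a b (7 * k + r) = u ^ (7 * k\<^sup>2 + 2 * k * r) * tate7_form a b r" for k r
    unfolding u_def by (rule tate7_form_closed)
  have form2: "tate7_form a b 2 = a\<^sup>2 * b * (- 1) ^ 3"
    and form5: "tate7_form a b 5 = a\<^sup>2 * b * u ^ 3"
    by (simp_all add: tate7_form_small u_def power_mult_distrib flip: power_mult) algebra
  have "\<exists>k r e. n = 7 * k + r \<and> (r = 2 \<or> r = 5) \<and> 7 * k\<^sup>2 + 2 * k * r = e * 3"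
  proof -
    have "n = 21 * j + n mod 21" unfolding j_def by simp
    then consider "n = 7 * (3 * j) + 2" | "n = 7 * (3 * j) + 5"
      | "n = 7 * (3 * j + 2) + 2" | "n = 7 * (3 * j + 2) + 5"
      using assms by fastforce
    then show ?thesis
    proof cases
      case 1
      moreover have "7 * (3 * j)\<^sup>2 + 2 * (3 * j) * 2 = (21 * j\<^sup>2 + 4 * j) * 3"
        by (simp add: power2_eq_square)
      ultimately show ?thesis by blast
    next
      case 2
      moreover have "7 * (3 * j)\<^sup>2 + 2 * (3 * j) * 5 = (21 * j\<^sup>2 + 10 * j) * 3"
        by (simp add: power2_eq_square)
      ultimately show ?thesis by blast
    next
      case 3
      moreover have "7 * (3 * j + 2)\<^sup>2 + 2 * (3 * j + 2) * 2 = (21 * j\<^sup>2 + 32 * j + 12) * 3"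
        by (simp add: power2_eq_square algebra_simps)
      ultimately show ?thesis by blast
    next
      case 4
      moreover have "7 * (3 * j + 2)\<^sup>2 + 2 * (3 * j + 2) * 5 = (21 * j\<^sup>2 + 38 * j + 16) * 3"
        by (simp add: power2_eq_square algebra_simps)
      ultimately show ?thesis by blast
    qed
  qed
  then obtain k r e where n: "n = 7 * k + r" and r: "r = 2 \<or> r = 5"
    and e: "7 * k\<^sup>2 + 2 * k * r = e * 3" by blast
  from r form2 form5 obtain w where "tate7_form a b r = a\<^sup>2 * b * w ^ 3" by blast
  then have "tate7_form a b n = a\<^sup>2 * b * (u ^ e * w) ^ 3"
    unfolding n closed e by (simp add: power_mult power_mult_distrib)
  then show ?thesis by blast
qed

theorem theorem5p10:
  fixes \<alpha> :: int and h :: "nat \<Rightarrow> rat"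
  assumes "\<alpha> \<notin> {0, 1}"
    and "tate7_eds \<alpha> h"
  shows "(\<forall>n. [n = 6] (mod 14) \<or> [n = 8] (mod 14) \<longrightarrow>
            \<not> (\<exists>k. h n = of_int k \<and> signed_square k)) \<and>
         (\<forall>n. [n = 2] (mod 21) \<or> [n = 5] (mod 21) \<or> [n = 16] (mod 21) \<or> [n = 19] (mod 21) \<longrightarrow>
            \<not> (\<exists>k. h n = of_int k \<and> nonzero_cube k))"
proof (intro conjI allI impI)
  fix n :: nat
  assume "[n = 6] (mod 14) \<or> [n = 8] (mod 14)"
  then have "n mod 14 = 6 \<or> n mod 14 = 8"
    by (auto simp: cong_def)
  \<comment> \<open>No integer lies strictly between 0 and 1, so the two factors never have opposite
    signs.\<close>
  moreover have "0 \<le> \<alpha> * (\<alpha> - 1)"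
    using assms(1) by (auto simp: zero_le_mult_iff)
  ultimately obtain t where "\<bar>tate7_form \<alpha> (\<alpha> - 1) n\<bar> = \<alpha> * (\<alpha> - 1) * t\<^sup>2"
    using abs_tate7_form_mod_14 by blast
  then have "\<not> signed_square (tate7_form \<alpha> (\<alpha> - 1) n)"
    by (rule consecutive_product_times_square_not_signed_square[OF assms(1)])
  then show "\<not> (\<exists>k. h n = of_int k \<and> signed_square k)"
    using tate7_eds_eq_form[OF assms] by auto
next
  fix n :: nat
  assume "[n = 2] (mod 21) \<or> [n = 5] (mod 21) \<or> [n = 16] (mod 21) \<or> [n = 19] (mod 21)"
  then have "n mod 21 \<in> {2, 5, 16, 19}"
    by (auto simp: cong_def)
  then obtain t where "tate7_form \<alpha> (\<alpha> - 1) n = \<alpha>\<^sup>2 * (\<alpha> - 1) * t ^ 3"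
    using tate7_form_mod_21 by blast
  then have "\<not> nonzero_cube (tate7_form \<alpha> (\<alpha> - 1) n)"
    by (rule square_times_pred_times_cube_not_nonzero_cube[OF assms(1)])
  then show "\<not> (\<exists>k. h n = of_int k \<and> nonzero_cube k)"
    using tate7_eds_eq_form[OF assms] by auto
qed

end
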